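(* Let $C$ be an affine configuration, let $d$ be a positive integer, and let $c,\alpha>0$ be such that $\mathrm{ex}(k,d,C)\le c\,k^{d-\alpha}$ for every sufficiently large positive integer $k$. Then, as $n\to\infty$, $$\mathrm{ex}(n,C)\le (1+o(1))\,c\left(\frac{2d}{\pi n}\right)^{\alpha/2}2^{n}.$$
   Context: An affine formula is an expression built from variables, the operations $\cap$ and $\cup$, and parentheses (no complements or constants). An affine statement is a statement of the form $f\subset g$ or $f=g$ with $f,g$ affine formulas. An affine configuration $C$ in variables $x_1,\dots,x_k$ is a Boolean expression (using $\land,\lor,\neg$) whose atoms are affine statements. A family $H\subset 2^{[n]}$ contains $C$ if there exist $k$ distinct elements of $H$ which, substituted for $x_1,\dots,x_k$, satisfy $C$; otherwise $H$ avoids $C$. $\mathrm{ex}(n,C)$ is the maximum size of a family $H\subset 2^{[n]}$ avoiding $C$. A $d$-dimensional grid is $[k_1]\times\dots\times[k_d]$ with $\subset$ meaning coordinatewise $\le$, $\cap$ the coordinatewise minimum and $\cup$ the coordinatewise maximum; containing/avoiding $C$ for a subset of a grid $F$ is defined in the same way, $\mathrm{ex}(F,C)$ is the maximum size of a subset of $F$ avoiding $C$, and $\mathrm{ex}(k,d,C)=\mathrm{ex}([k]^d,C)$. *)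

theory Defs
  imports Complex_Main "HOL-Library.FuncSet" "HOL-Library.Landau_Symbols"
begin

datatype affine_formula =
    Var nat
  | Meet affine_formula affine_formula
  | Join affine_formula affine_formula

text \<open>
  The statement \<open>f \<subset> g\<close> is the non-strict relation: inclusion for sets, coordinatewise
  \<open>\<le>\<close> in grids.
\<close>

datatype affine_config =
    Sub affine_formula affine_formula
  | Eql affine_formula affine_formula
  | Conj affine_config affine_config
  | Disj affine_config affine_config
  | Neg affine_config

primrec formula_vars :: "affine_formula \<Rightarrow> nat set" where
  "formula_vars (Var i) = {i}"
| "formula_vars (Meet f g) = formula_vars f \<union> formula_vars g"
| "formula_vars (Join f g) = formula_vars f \<union> formula_vars g"

primrec config_vars :: "affine_config \<Rightarrow> nat set" where
  "config_vars (Sub f g) = formula_vars f \<union> formula_vars g"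
| "config_vars (Eql f g) = formula_vars f \<union> formula_vars g"
| "config_vars (Conj A B) = config_vars A \<union> config_vars B"
| "config_vars (Disj A B) = config_vars A \<union> config_vars B"
| "config_vars (Neg A) = config_vars A"

text \<open>
  A configuration comes with its number \<open>m\<close> of variables \<open>x\<^sub>1, \<dots>, x\<^sub>m\<close>; not all of them have
  to occur in the expression, but containment always asks for \<open>m\<close> distinct elements.
\<close>

definition affine_configuration :: "nat \<Rightarrow> affine_config \<Rightarrow> bool" where
  "affine_configuration m C \<longleftrightarrow> config_vars C \<subseteq> {1..m}"

text \<open>
  Formulas are evaluated in an arbitrary lattice. On \<^typ>\<open>nat set\<close>, \<^const>\<open>inf\<close> and \<^const>\<open>sup\<close>
  are intersection and union; on \<^typ>\<open>nat \<Rightarrow> nat\<close> they are the pointwise minimum and maximum.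
\<close>

primrec eval_formula :: "(nat \<Rightarrow> 'a::lattice) \<Rightarrow> affine_formula \<Rightarrow> 'a" where
  "eval_formula x (Var i) = x i"
| "eval_formula x (Meet f g) = inf (eval_formula x f) (eval_formula x g)"
| "eval_formula x (Join f g) = sup (eval_formula x f) (eval_formula x g)"

primrec satisfies :: "(nat \<Rightarrow> 'a::lattice) \<Rightarrow> affine_config \<Rightarrow> bool" where
  "satisfies x (Sub f g) \<longleftrightarrow> eval_formula x f \<le> eval_formula x g"
| "satisfies x (Eql f g) \<longleftrightarrow> eval_formula x f = eval_formula x g"
| "satisfies x (Conj A B) \<longleftrightarrow> satisfies x A \<and> satisfies x B"
| "satisfies x (Disj A B) \<longleftrightarrow> satisfies x A \<or> satisfies x B"
| "satisfies x (Neg A) \<longleftrightarrow> \<not> satisfies x A"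

definition contains_config :: "nat \<Rightarrow> affine_config \<Rightarrow> 'a::lattice set \<Rightarrow> bool" where
  "contains_config m C H \<longleftrightarrow> (\<exists>x. inj_on x {1..m} \<and> x ` {1..m} \<subseteq> H \<and> satisfies x C)"

definition avoids_config :: "nat \<Rightarrow> affine_config \<Rightarrow> 'a::lattice set \<Rightarrow> bool" where
  "avoids_config m C H \<longleftrightarrow> \<not> contains_config m C H"

text \<open>
  Every configuration has at least one variable, so the empty set avoids it and the maximum below
  is over a nonempty set; it is meaningful for finite \<open>F\<close>.
\<close>

definition ex_in :: "'a::lattice set \<Rightarrow> nat \<Rightarrow> affine_config \<Rightarrow> nat" where
  "ex_in F m C = Max {card H | H. H \<subseteq> F \<and> avoids_config m C H}"

definition ex_cube :: "nat \<Rightarrow> nat \<Rightarrow> affine_config \<Rightarrow> nat" where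
  "ex_cube n m C = ex_in (Pow {1..n}) m C"

text \<open>
  Points of \<open>[k 1] \<times> \<dots> \<times> [k d]\<close> are functions on \<open>{1..d}\<close> made total with the fixed value
  \<^const>\<open>undefined\<close> elsewhere, so the order, minimum and maximum of \<^typ>\<open>nat \<Rightarrow> nat\<close>
  restrict to the coordinatewise ones.
\<close>

definition grid :: "nat \<Rightarrow> (nat \<Rightarrow> nat) \<Rightarrow> (nat \<Rightarrow> nat) set" where
  "grid d k = (\<Pi>\<^sub>E i\<in>{1..d}. {1..k i})"

definition ex_grid :: "nat \<Rightarrow> nat \<Rightarrow> nat \<Rightarrow> affine_config \<Rightarrow> nat" where
  "ex_grid k d m C = ex_in (grid d (\<lambda>_. k)) m C"

end

theory Submission
  imports Defs "HOL-Analysis.Gamma_Function" "HOL-Combinatorics.Multiset_Permutations"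
begin

text \<open>
  A product of \<open>d\<close> chains of length \<open>k\<close>, one in the power set of each block of a partition of
  \<open>{1..n}\<close> into \<open>d\<close> parts, is a sublattice isomorphic to \<open>[k]\<^sup>d\<close>, so a family avoiding \<open>C\<close> meets it
  in at most \<open>ex(k,d,C)\<close> sets. It remains to average over random chains of length \<open>k\<close> that cover
  every subset of a block with the same probability. Such a chain is a uniformly random maximal
  chain restricted to a random set of \<open>k\<close> levels in which the level \<open>l\<close> of an \<open>N\<close>-set occurs with
  probability \<open>k * (N choose l) / 2 ^ N\<close>; this is possible as soon as
  \<open>k * (N choose N div 2) \<le> 2 ^ N\<close>. Averaging gives \<open>ex(n,C) * k ^ d \<le> 2 ^ n * ex(k,d,C)\<close>, and by
  Wallis' product the largest admissible \<open>k\<close> is asymptotic to \<open>sqrt (pi * n / (2 * d))\<close>.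
\<close>

section \<open>Lattice embeddings\<close>

text \<open>Formulas contain no constants, so every atom mentions a variable. For an
  \<open>affine_configuration\<close> this gives \<open>m > 0\<close>, which makes the empty family
  avoid \<open>C\<close>.\<close>

lemma config_vars_nonempty: "config_vars C \<noteq> {}"
proof -
  have "formula_vars f \<noteq> {}" for f
    by (induction f) auto
  then show ?thesis
    by (induction C) auto
qed

lemma affine_configuration_pos: "affine_configuration m C \<Longrightarrow> m > 0"
  using config_vars_nonempty[of C] by (cases m) (auto simp: affine_configuration_def)

text \<open>The domain is a set \<open>G\<close> closed under both operations, since a grid is a
  proper part of its function type. Order is preserved and reflected by injectivity, as
  \<open>u \<le> v\<close> means \<open>inf u v = u\<close>.\<close>

locale lattice_embedding_on =
  fixes G :: "'a::lattice set" and \<Phi> :: "'a \<Rightarrow> 'b::lattice"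
  assumes inf_closed: "u \<in> G \<Longrightarrow> v \<in> G \<Longrightarrow> inf u v \<in> G"
    and sup_closed: "u \<in> G \<Longrightarrow> v \<in> G \<Longrightarrow> sup u v \<in> G"
    and hom_inf: "u \<in> G \<Longrightarrow> v \<in> G \<Longrightarrow> \<Phi> (inf u v) = inf (\<Phi> u) (\<Phi> v)"
    and hom_sup: "u \<in> G \<Longrightarrow> v \<in> G \<Longrightarrow> \<Phi> (sup u v) = sup (\<Phi> u) (\<Phi> v)"
    and inj: "inj_on \<Phi> G"
begin

lemma eval_formula_hom:
  assumes "formula_vars f \<subseteq> I" "x ` I \<subseteq> G"
  shows "eval_formula x f \<in> G \<and> eval_formula (\<Phi> \<circ> x) f = \<Phi> (eval_formula x f)"
  using assms by (induction f) (auto simp: inf_closed sup_closed hom_inf hom_sup)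

lemma le_iff: "u \<in> G \<Longrightarrow> v \<in> G \<Longrightarrow> \<Phi> u \<le> \<Phi> v \<longleftrightarrow> u \<le> v"
  by (metis hom_inf inf.absorb_iff1 inf_closed inj inj_on_def)

lemma satisfies_hom:
  assumes "config_vars C \<subseteq> I" "x ` I \<subseteq> G"
  shows "satisfies (\<Phi> \<circ> x) C \<longleftrightarrow> satisfies x C"
  using assms
proof (induction C)
  case (Sub f g)
  then show ?case
    using eval_formula_hom[of f I x] eval_formula_hom[of g I x]
    by (simp add: le_iff del: comp_apply)
next
  case (Eql f g)
  then show ?case
    using eval_formula_hom[of f I x] eval_formula_hom[of g I x] inj_on_eq_iff[OF inj]
    by (simp del: comp_apply)
qed auto

text \<open>A copy of \<open>C\<close> in the preimage would be carried by \<open>\<Phi>\<close> to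
  a copy in \<open>H\<close>: injectivity keeps its elements distinct, and the truth of
  \<open>C\<close> is preserved.\<close>

lemma avoids_config_vimage:
  assumes "affine_configuration m C" "avoids_config m C H"
  shows "avoids_config m C {x \<in> G. \<Phi> x \<in> H}"
  unfolding avoids_config_def contains_config_def
proof
  assume "\<exists>x. inj_on x {1..m} \<and> x ` {1..m} \<subseteq> {x \<in> G. \<Phi> x \<in> H} \<and> satisfies x C"
  then obtain x where x: "inj_on x {1..m}" "x ` {1..m} \<subseteq> {x \<in> G. \<Phi> x \<in> H}" "satisfies x C"
    by blast
  then have G: "x ` {1..m} \<subseteq> G" by auto
  then have "inj_on (\<Phi> \<circ> x) {1..m}"
    using x(1) inj by (auto intro!: comp_inj_on intro: inj_on_subset)
  moreover have "satisfies (\<Phi> \<circ> x) C"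
    using satisfies_hom[of C "{1..m}" x] G x(3) assms(1) by (auto simp: affine_configuration_def)
  moreover have "(\<Phi> \<circ> x) ` {1..m} \<subseteq> H"
    using x(2) by auto
  ultimately show False
    using assms(2) unfolding avoids_config_def contains_config_def by blast
qed

end

section \<open>Extremal numbers of finite sets as attained maxima\<close>

lemma card_le_ex_in:
  assumes "finite F" "H \<subseteq> F" "avoids_config m C H"
  shows "card H \<le> ex_in F m C"
  unfolding ex_in_def
proof (rule Max_ge)
  have "{card H |H. H \<subseteq> F \<and> avoids_config m C H} \<subseteq> card ` Pow F" by auto
  then show "finite {card H |H. H \<subseteq> F \<and> avoids_config m C H}"
    by (rule finite_subset) (use assms in auto)
qed (use assms in auto)

lemma ex_in_attained:
  assumes "finite F" "m > 0"
  obtains H where "H \<subseteq> F" "avoids_config m C H" "card H = ex_in F m C"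
proof -
  let ?S = "{card H |H. H \<subseteq> F \<and> avoids_config m C H}"
  have "?S \<subseteq> card ` Pow F" by auto
  then have "finite ?S"
    by (rule finite_subset) (use assms in auto)
  moreover have "avoids_config m C {}"
    using assms(2) by (auto simp: avoids_config_def contains_config_def)
  then have "?S \<noteq> {}" by blast
  ultimately have "Max ?S \<in> ?S" by (rule Max_in)
  then show ?thesis using that unfolding ex_in_def by auto
qed

section \<open>Chains covering a power set uniformly\<close>

text \<open>The numbers below the total are cut into consecutive intervals, the \<open>l\<close>-th
  of length \<open>b l\<close>; \<open>f\<close> returns the index of the interval containing its
  argument.\<close>

lemma level_function:
  fixes b :: "nat \<Rightarrow> nat"
  obtains f where "\<And>u. u < (\<Sum>l\<le>N. b l) \<Longrightarrow> f u \<le> N"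
    "\<And>l. l \<le> N \<Longrightarrow> {u. u < (\<Sum>l\<le>N. b l) \<and> f u = l} = {(\<Sum>i<l. b i)..<(\<Sum>i\<le>l. b i)}"
proof -
  define B where "B l = (\<Sum>i\<le>l. b i)" for l
  define f where "f u = (LEAST l. u < B l)" for u
  have mono: "B l \<le> B l'" if "l \<le> l'" for l l'
    unfolding B_def using that by (intro sum_mono2) auto
  have B': "(\<Sum>i<l. b i) = (case l of 0 \<Rightarrow> 0 | Suc l' \<Rightarrow> B l')" for l
    by (cases l) (auto simp: B_def lessThan_Suc_atMost)
  have le: "f u \<le> N" if "u < B N" for u
    unfolding f_def using that by (rule Least_le)
  have lt: "u < B (f u)" if "u < B N" for u
    unfolding f_def using that by (rule LeastI)
  have "{u. u < B N \<and> f u = l} = {(\<Sum>i<l. b i)..<B l}" if "l \<le> N" for l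
  proof (intro set_eqI iffI)
    fix u assume u: "u \<in> {u. u < B N \<and> f u = l}"
    have "\<not> u < B l'" if "l = Suc l'" for l'
      using u not_less_Least[of l' "\<lambda>l. u < B l"] that by (auto simp: f_def)
    then show "u \<in> {(\<Sum>i<l. b i)..<B l}"
      using u lt[of u] by (auto simp: B' not_less split: nat.split)
  next
    fix u assume u: "u \<in> {(\<Sum>i<l. b i)..<B l}"
    then have N: "u < B N" using mono[OF that] by simp
    have "\<not> u < B j" if "j < l" for j
      using u that mono[of j "l - 1"] B'[of l] by (cases l) auto
    then have "f u = l"
      unfolding f_def using u by (intro Least_equality) (auto simp: not_less[symmetric])
    then show "u \<in> {u. u < B N \<and> f u = l}" using N by simp
  qed
  then show ?thesis using that[of f] le unfolding B_def by blast
qed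

lemma shift_mod_cancel:
  fixes t t' s M :: nat
  assumes "t < M" "t' < M" "(t + s) mod M = (t' + s) mod M"
  shows "t = t'"
proof -
  have False if "t < t'" "t' < M" "(t + s) mod M = (t' + s) mod M" for t t'
  proof -
    have "M dvd (t' + s) - (t + s)"
      using that by (subst mod_eq_dvd_iff_nat[symmetric]) auto
    then show False using that(1,2) by (auto dest: dvd_imp_le)
  qed
  from this[of t t'] this[of t' t] show ?thesis
    using assms by (cases t t' rule: linorder_cases) auto
qed

text \<open>Rotation of a cycle is an injective self-map of a finite set, hence a permutation of
  it.\<close>

lemma card_shift_mod:
  fixes M s :: nat
  assumes "I \<subseteq> {..<M}"
  shows "card {t. t < M \<and> (t + s) mod M \<in> I} = card I"
proof -
  let ?h = "\<lambda>t. (t + s) mod M"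
  have inj: "inj_on ?h {..<M}"
    by (auto intro!: inj_onI dest: shift_mod_cancel)
  moreover have "?h ` {..<M} \<subseteq> {..<M}" by auto
  ultimately have surj: "?h ` {..<M} = {..<M}"
    by (intro endo_inj_surj) auto
  have "?h ` {t. t < M \<and> ?h t \<in> I} = ?h ` {..<M} \<inter> I" by blast
  also have "\<dots> = I" using assms surj by auto
  finally show ?thesis
    using card_image[OF inj_on_subset[OF inj, of "{t. t < M \<and> ?h t \<in> I}"]]
    by (simp add: subset_eq)
qed

text \<open>One way round the cycle the two points are at least one step \<open>L\<close> apart
  because \<open>j < j'\<close>; the other way round, because \<open>k * L \<le> M\<close> leaves
  room for a further step after the last point.\<close>

lemma shift_mod_gap:
  fixes t j j' k L M :: nat
  assumes "t < M" "j < j'" "j' < k" "k * L \<le> M"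
  defines "u \<equiv> (t + j * L) mod M" and "u' \<equiv> (t + j' * L) mod M"
  shows "u + L \<le> u' \<or> u' + L \<le> u"
proof -
  have jj: "j * L + L \<le> j' * L"
    using assms(2) mult_le_mono1[of "Suc j" j' L] by simp
  have kk: "j' * L + L \<le> M"
    using assms(3,4) mult_le_mono1[of "Suc j'" k L] by simp
  show ?thesis
  proof (cases "L = 0")
    case False
    \<comment> \<open>With \<open>t\<close> and the shift both below \<open>M\<close>, reduction
      subtracts \<open>M\<close> at most once. For the shifts \<open>j * L\<close> and
      \<open>j' * L\<close> this uses \<open>L > 0\<close>.\<close>
    have *: "(t + a) mod M = (if t + a < M then t + a else t + a - M)" if "a < M" for a
      using that assms(1) by (auto simp: mod_if)
    show ?thesis
      unfolding u_def u'_def using jj kk False assms(1) by (subst (1 2 3 4) *) auto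
  qed auto
qed

text \<open>
  Systematic sampling: concatenate intervals of lengths \<open>b 0, \<dots>, b N\<close> on a circle of length \<open>M\<close> and
  let \<open>S t\<close> collect the intervals hit by \<open>t, t + L, \<dots>, t + (k - 1) * L\<close>. These points are at cyclic
  distance at least \<open>L\<close>, hence lie in distinct intervals.
\<close>

lemma level_sampling:
  fixes b :: "nat \<Rightarrow> nat"
  assumes le: "\<And>l. l \<le> N \<Longrightarrow> b l \<le> L" and kL: "k * L \<le> M" and M: "M = (\<Sum>l\<le>N. b l)"
  obtains S where "\<And>t. t < M \<Longrightarrow> S t \<subseteq> {..N} \<and> card (S t) = k"
    "\<And>l. l \<le> N \<Longrightarrow> card {t. t < M \<and> l \<in> S t} = k * b l"
proof -
  obtain f where f: "\<And>u. u < M \<Longrightarrow> f u \<le> N"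
    "\<And>l. l \<le> N \<Longrightarrow> {u. u < M \<and> f u = l} = {(\<Sum>i<l. b i)..<(\<Sum>i\<le>l. b i)}"
    using level_function[where b=b and N=N] unfolding M by metis
  have card_level: "card {u. u < M \<and> f u = l} = b l" if "l \<le> N" for l
    using f(2)[OF that] by (simp add: lessThan_Suc_atMost[symmetric])
  \<comment> \<open>Two points of one interval differ by less than its length, which is at most
    \<open>L\<close>; sample points at distance at least \<open>L\<close> thus get different
    levels.\<close>
  have near: "u' < u + L" if "u < M" "u' < M" "f u = f u'" for u u'
  proof -
    let ?l = "f u"
    have "u \<in> {u. u < M \<and> f u = ?l}" "u' \<in> {u. u < M \<and> f u = ?l}"
      using that by auto
    then have "(\<Sum>i<?l. b i) \<le> u" "u' < (\<Sum>i<?l. b i) + b ?l"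
      using f(2)[OF f(1)[OF that(1)]] by (auto simp: lessThan_Suc_atMost[symmetric])
    then show ?thesis using le[OF f(1)[OF that(1)]] by linarith
  qed
  define u where "u t j = (t + j * L) mod M" for t j
  have uM: "u t j < M" if "t < M" for t j
    using that by (simp add: u_def)
  have inj: "inj_on (\<lambda>j. f (u t j)) {..<k}" if t: "t < M" for t
  proof (rule linorder_inj_onI)
    fix j j' assume *: "j < j'" "j \<in> {..<k}" "j' \<in> {..<k}"
    then have "u t j + L \<le> u t j' \<or> u t j' + L \<le> u t j"
      unfolding u_def using shift_mod_gap[OF t *(1) _ kL] by auto
    then show "f (u t j) \<noteq> f (u t j')"
      using near[of "u t j" "u t j'"] near[of "u t j'" "u t j"] uM[OF t] by force
  qed auto
  define S where "S t = (\<lambda>j. f (u t j)) ` {..<k}" for t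
  show ?thesis
  proof
    show "S t \<subseteq> {..N} \<and> card (S t) = k" if "t < M" for t
      using inj[OF that] f(1) uM[OF that] by (auto simp: S_def card_image)
  next
    fix l assume l: "l \<le> N"
    \<comment> \<open>Distinct \<open>j\<close> give distinct levels, so the union is disjoint. For
      each \<open>j\<close>, rotation by \<open>j * L\<close> shows that exactly \<open>b l\<close>
      offsets hit level \<open>l\<close>.\<close>
    have "{t. t < M \<and> l \<in> S t} = (\<Union>j<k. {t. t < M \<and> f (u t j) = l})"
      by (auto simp: S_def)
    also have "card \<dots> = (\<Sum>j<k. card {t. t < M \<and> f (u t j) = l})"
      by (rule card_UN_disjoint) (use inj in \<open>auto dest: inj_onD\<close>)
    also have "\<dots> = (\<Sum>j<k. b l)"
    proof (rule sum.cong[OF refl])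
      fix j
      have "{t. t < M \<and> f (u t j) = l} = {t. t < M \<and> (t + j * L) mod M \<in> {u. u < M \<and> f u = l}}"
        using uM by (auto simp: u_def)
      also have "card \<dots> = b l"
        using card_level[OF l] by (subst card_shift_mod) auto
      finally show "card {t. t < M \<and> f (u t j) = l} = b l" .
    qed
    finally show "card {t. t < M \<and> l \<in> S t} = k * b l" by simp
  qed
qed

text \<open>Such a permutation is an arrangement of \<open>A\<close> followed by one of
  \<open>X - A\<close>. The count is the number of maximal chains through \<open>A\<close>.\<close>

lemma card_permutations_with_prefix_set:
  assumes "finite X" "A \<subseteq> X"
  shows "card {xs \<in> permutations_of_set X. set (take (card A) xs) = A}
    = fact (card A) * fact (card X - card A)"
proof -
  have fin: "finite A" using assms finite_subset by blast
  have "bij_betw (\<lambda>(ys, zs). ys @ zs) (permutations_of_set A \<times> permutations_of_set (X - A))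
    {xs \<in> permutations_of_set X. set (take (card A) xs) = A}"
    unfolding bij_betw_def
  proof (intro conjI set_eqI iffI)
    show "inj_on (\<lambda>(ys, zs). ys @ zs) (permutations_of_set A \<times> permutations_of_set (X - A))"
      by (auto intro!: inj_onI simp: length_finite_permutations_of_set)
  next
    fix xs assume "xs \<in> (\<lambda>(ys, zs). ys @ zs) ` (permutations_of_set A \<times> permutations_of_set (X - A))"
    then show "xs \<in> {xs \<in> permutations_of_set X. set (take (card A) xs) = A}"
      using assms by (auto simp: permutations_of_set_def distinct_card)
  next
    fix xs assume xs: "xs \<in> {xs \<in> permutations_of_set X. set (take (card A) xs) = A}"
    then have d: "distinct xs" "set xs = X" "set (take (card A) xs) = A"
      by (auto simp: permutations_of_set_def)
    have "set (take (card A) xs) \<union> set (drop (card A) xs) = X"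
      using d(2) by (metis append_take_drop_id set_append)
    moreover have "set (take (card A) xs) \<inter> set (drop (card A) xs) = {}"
      using d(1) by (simp add: set_take_disj_set_drop_if_distinct)
    ultimately have "set (drop (card A) xs) = X - A" using d(3) by blast
    then have "(take (card A) xs, drop (card A) xs) \<in> permutations_of_set A \<times> permutations_of_set (X - A)"
      using d by (auto simp: permutations_of_set_def)
    then show "xs \<in> (\<lambda>(ys, zs). ys @ zs) ` (permutations_of_set A \<times> permutations_of_set (X - A))"
      by (intro image_eqI[of _ _ "(take (card A) xs, drop (card A) xs)"]) auto
  qed
  from bij_betw_same_card[OF this] show ?thesis
    using assms fin by (simp add: card_cartesian_product card_Diff_subset)
qed

text \<open>A point of \<open>\<Omega>\<close> is a permutation of \<open>X\<close>, read as the
  maximal chain of its prefix sets, with a sampling offset; \<open>g\<close> keeps the prefixes of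
  sampled length. A set of size \<open>l\<close> lies on \<open>l! (N - l)!\<close> maximal chains
  and its level is sampled by \<open>k * (N choose l)\<close> offsets; the product does not depend
  on \<open>l\<close>.\<close>

lemma uniform_chains:
  fixes X :: "'a set"
  assumes "finite X" and k: "\<And>j. k * (card X choose j) \<le> 2 ^ card X"
  obtains \<Omega> :: "('a list \<times> nat) set" and g :: "'a list \<times> nat \<Rightarrow> nat \<Rightarrow> 'a set"
  where "finite \<Omega>" "card \<Omega> = fact (card X) * 2 ^ card X"
    "\<And>\<omega>. \<omega> \<in> \<Omega> \<Longrightarrow> strict_mono_on {1..k} (g \<omega>)"
    "\<And>\<omega> j. \<omega> \<in> \<Omega> \<Longrightarrow> j \<in> {1..k} \<Longrightarrow> g \<omega> j \<subseteq> X"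
    "\<And>A. A \<subseteq> X \<Longrightarrow> card {\<omega> \<in> \<Omega>. A \<in> g \<omega> ` {1..k}} = k * fact (card X)"
proof -
  define N where "N = card X"
  define M where "M = (2::nat) ^ N"
  \<comment> \<open>The interval lengths are the binomial coefficients, with sum
    \<open>2 ^ N\<close>; the spacing \<open>L\<close> is the largest of them.\<close>
  obtain S where S: "\<And>t. t < M \<Longrightarrow> S t \<subseteq> {..N} \<and> card (S t) = k"
    "\<And>l. l \<le> N \<Longrightarrow> card {t. t < M \<and> l \<in> S t} = k * (N choose l)"
  proof (rule level_sampling)
    show "(N choose l) \<le> N choose (N div 2)" for l by (rule binomial_maximum)
    show "k * (N choose (N div 2)) \<le> M" using k by (simp add: M_def N_def)
    show "M = (\<Sum>l\<le>N. N choose l)" by (simp add: M_def choose_row_sum)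
  qed (rule that)
  \<comment> \<open>The shift \<open>j - 1\<close> matches grid coordinates starting at 1 with list
    positions starting at 0.\<close>
  define s where "s t j = sorted_list_of_set (S t) ! (j - 1)" for t j
  have finS: "finite (S t)" if "t < M" for t
    using S(1)[OF that] finite_subset by blast
  have s_image: "s t ` {1..k} = S t" if "t < M" for t
  proof -
    have "s t ` {1..k} = s t ` Suc ` {..<k}"
      by (simp add: image_Suc_lessThan)
    also have "\<dots> = (!) (sorted_list_of_set (S t)) ` {..<length (sorted_list_of_set (S t))}"
      using S(1)[OF that] by (simp add: s_def image_image)
    also have "\<dots> = set (sorted_list_of_set (S t))"
      by (auto simp: set_conv_nth)
    finally show ?thesis using finS[OF that] by simp
  qed
  have s_less: "s t i < s t j" if "t < M" "i \<in> {1..k}" "j \<in> {1..k}" "i < j" for t i j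
    unfolding s_def using that S(1)[OF that(1)]
    by (intro sorted_wrt_nth_less[OF strict_sorted_list_of_set]) auto
  define \<Omega> where "\<Omega> = permutations_of_set X \<times> {..<M}"
  define g :: "'a list \<times> nat \<Rightarrow> nat \<Rightarrow> 'a set" where "g = (\<lambda>(xs, t) j. set (take (s t j) xs))"
  have length: "length xs = N" "distinct xs" "set xs = X" if "xs \<in> permutations_of_set X" for xs
    using that by (auto simp: permutations_of_set_def N_def distinct_card)
  have card_take: "card (set (take l xs)) = l" if "xs \<in> permutations_of_set X" "l \<le> N" for xs l
    using length[OF that(1)] that(2) by (simp add: distinct_card)
  have sN: "s t j \<le> N" if "t < M" "j \<in> {1..k}" for t j
    using s_image[OF that(1)] S(1)[OF that(1)] that(2) by blast
  show ?thesis
  proof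
    show "finite \<Omega>" by (simp add: \<Omega>_def)
    show "card \<Omega> = fact (card X) * 2 ^ card X"
      using assms(1) by (simp add: \<Omega>_def M_def N_def card_cartesian_product)
  next
    fix \<omega> assume "\<omega> \<in> \<Omega>"
    then obtain xs t where \<omega>: "\<omega> = (xs, t)" "xs \<in> permutations_of_set X" "t < M"
      by (auto simp: \<Omega>_def)
    show "strict_mono_on {1..k} (g \<omega>)"
    proof (rule strict_mono_onI)
      fix i j assume ij: "i \<in> {1..k}" "j \<in> {1..k}" "i < j"
      have "g \<omega> i \<subseteq> g \<omega> j"
        using s_less[OF \<omega>(3) ij] set_take_subset_set_take[of "s t i" "s t j" xs]
        by (simp add: g_def \<omega>(1))
      moreover have "card (g \<omega> i) \<noteq> card (g \<omega> j)"
        using s_less[OF \<omega>(3) ij] card_take[OF \<omega>(2)] sN[OF \<omega>(3)] ij by (simp add: g_def \<omega>(1))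
      ultimately show "g \<omega> i < g \<omega> j" by auto
    qed
    show "g \<omega> j \<subseteq> X" for j
      using length(3)[OF \<omega>(2)] set_take_subset[of "s t j" xs] by (simp add: g_def \<omega>(1))
  next
    fix A assume A: "A \<subseteq> X"
    then have AN: "card A \<le> N" using assms(1) by (simp add: N_def card_mono)
    \<comment> \<open>Only the prefix of length \<open>card A\<close> can equal \<open>A\<close>, so
      the event splits into a condition on the permutation and one on the offset.\<close>
    have "{\<omega> \<in> \<Omega>. A \<in> g \<omega> ` {1..k}} =
      {xs \<in> permutations_of_set X. set (take (card A) xs) = A} \<times> {t. t < M \<and> card A \<in> S t}"
    proof (intro set_eqI iffI)
      fix \<omega> assume *: "\<omega> \<in> {\<omega> \<in> \<Omega>. A \<in> g \<omega> ` {1..k}}"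
      then obtain xs t where xt: "\<omega> = (xs, t)" "xs \<in> permutations_of_set X" "t < M"
        by (auto simp: \<Omega>_def)
      with * obtain j where j: "j \<in> {1..k}" "A = set (take (s t j) xs)" by (auto simp: g_def)
      have "card A = s t j" using card_take[OF xt(2) sN[OF xt(3) j(1)]] j(2) by simp
      then show "\<omega> \<in> {xs \<in> permutations_of_set X. set (take (card A) xs) = A} \<times> {t. t < M \<and> card A \<in> S t}"
        using xt j s_image[OF xt(3)] by auto
    next
      fix \<omega> assume "\<omega> \<in> {xs \<in> permutations_of_set X. set (take (card A) xs) = A} \<times> {t. t < M \<and> card A \<in> S t}"
      then obtain xs t where xt: "\<omega> = (xs, t)" "xs \<in> permutations_of_set X" "set (take (card A) xs) = A"
        "t < M" "card A \<in> S t"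
        by auto
      then have "card A \<in> s t ` {1..k}" by (simp only: s_image)
      then obtain j where j: "j \<in> {1..k}" "card A = s t j" by blast
      have "A = g \<omega> j" using xt(1,3) j(2) by (simp add: g_def)
      then show "\<omega> \<in> {\<omega> \<in> \<Omega>. A \<in> g \<omega> ` {1..k}}"
        using xt(1,2,4) j(1) by (simp add: \<Omega>_def)
    qed
    also have "card \<dots> = k * (fact (card A) * fact (N - card A) * (N choose card A))"
      using card_permutations_with_prefix_set[OF assms(1) A] S(2)[OF AN]
      by (simp add: card_cartesian_product N_def)
    also have "\<dots> = k * fact (card X)"
      using binomial_fact_lemma[OF AN] by (simp add: N_def)
    finally show "card {\<omega> \<in> \<Omega>. A \<in> g \<omega> ` {1..k}} = k * fact (card X)" .
  qed
qed

section \<open>Products of chains\<close>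

locale chain_product =
  fixes d k :: nat and P :: "nat \<Rightarrow> 'a set" and c :: "nat \<Rightarrow> nat \<Rightarrow> 'a set"
  assumes disjoint: "disjoint_family_on P {1..d}"
    and chain: "i \<in> {1..d} \<Longrightarrow> strict_mono_on {1..k} (c i)"
    and subset: "i \<in> {1..d} \<Longrightarrow> j \<in> {1..k} \<Longrightarrow> c i j \<subseteq> P i"
begin

definition merge :: "(nat \<Rightarrow> nat) \<Rightarrow> 'a set" where
  "merge x = (\<Union>i\<in>{1..d}. c i (x i))"

lemma grid_block_subset: "x \<in> grid d (\<lambda>_. k) \<Longrightarrow> i \<in> {1..d} \<Longrightarrow> c i (x i) \<subseteq> P i"
  by (rule subset) (auto simp: grid_def)

text \<open>The blocks are disjoint, so only the \<open>i\<close>-th chain contributes; this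
  recovers each coordinate from the union.\<close>

lemma merge_Int:
  assumes "x \<in> grid d (\<lambda>_. k)" "i \<in> {1..d}"
  shows "merge x \<inter> P i = c i (x i)"
proof -
  have "P i' \<inter> P i = {}" if "i' \<in> {1..d}" "i' \<noteq> i" for i'
    using disjoint assms(2) that by (auto simp: disjoint_family_on_def)
  then show ?thesis
    using grid_block_subset[OF assms(1)] assms(2) unfolding merge_def by blast
qed

lemma merge_subset: "x \<in> grid d (\<lambda>_. k) \<Longrightarrow> merge x \<subseteq> (\<Union>i\<in>{1..d}. P i)"
  using grid_block_subset unfolding merge_def by blast

lemma set_eqI_blocks:
  assumes "A \<subseteq> (\<Union>i\<in>{1..d}. P i)" "B \<subseteq> (\<Union>i\<in>{1..d}. P i)"
    and "\<And>i. i \<in> {1..d} \<Longrightarrow> A \<inter> P i = B \<inter> P i"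
  shows "A = B"
  using assms by blast

lemma chain_le_iff:
  "i \<in> {1..d} \<Longrightarrow> a \<in> {1..k} \<Longrightarrow> b \<in> {1..k} \<Longrightarrow> c i a \<subseteq> c i b \<longleftrightarrow> a \<le> b"
  using strict_mono_on_less_eq[OF chain] by blast

text \<open>Within one block, intersection and union of two sets of a chain are the sets at the
  smaller and the larger index. Disjoint blocks make this coordinatewise, and strictness of the
  chains gives injectivity.\<close>

lemma lattice_embedding_on_merge: "lattice_embedding_on (grid d (\<lambda>_. k)) merge"
proof
  fix u v assume uv: "u \<in> grid d (\<lambda>_. k)" "v \<in> grid d (\<lambda>_. k)"
  then have mem: "u i \<in> {1..k}" "v i \<in> {1..k}" if "i \<in> {1..d}" for i
    using that by (auto simp: grid_def)
  then have le: "u i \<le> v i \<Longrightarrow> c i (u i) \<subseteq> c i (v i)" "v i \<le> u i \<Longrightarrow> c i (v i) \<subseteq> c i (u i)"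
    if "i \<in> {1..d}" for i
    using chain_le_iff that by auto
  \<comment> \<open>Outside \<open>{1..d}\<close> both functions equal \<open>undefined\<close>,
    hence so do their minimum and maximum.\<close>
  show inf: "inf u v \<in> grid d (\<lambda>_. k)" and sup: "sup u v \<in> grid d (\<lambda>_. k)"
    using uv by (auto simp: grid_def PiE_iff extensional_def inf_nat_def sup_nat_def)
  show "merge (inf u v) = inf (merge u) (merge v)"
  proof (rule set_eqI_blocks)
    fix i assume i: "i \<in> {1..d}"
    have "c i (inf (u i) (v i)) = c i (u i) \<inter> c i (v i)"
      using le[OF i] by (cases "u i \<le> v i") (auto simp: inf_nat_def min_def)
    then show "merge (inf u v) \<inter> P i = inf (merge u) (merge v) \<inter> P i"
      using merge_Int[OF _ i] uv inf by (simp add: Int_Un_distrib2) blast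
  qed (use merge_subset uv inf in blast)+
  show "merge (sup u v) = sup (merge u) (merge v)"
  proof (rule set_eqI_blocks)
    fix i assume i: "i \<in> {1..d}"
    have "c i (sup (u i) (v i)) = c i (u i) \<union> c i (v i)"
      using le[OF i] by (cases "u i \<le> v i") (auto simp: sup_nat_def max_def)
    then show "merge (sup u v) \<inter> P i = sup (merge u) (merge v) \<inter> P i"
      using merge_Int[OF _ i] uv sup by (simp add: Int_Un_distrib2)
  qed (use merge_subset uv sup in blast)+
next
  show "inj_on merge (grid d (\<lambda>_. k))"
  proof (rule inj_onI)
    fix u v assume uv: "u \<in> grid d (\<lambda>_. k)" "v \<in> grid d (\<lambda>_. k)" "merge u = merge v"
    show "u = v"
    proof (rule PiE_ext)
      show "u \<in> (\<Pi>\<^sub>E i\<in>{1..d}. {1..k})" "v \<in> (\<Pi>\<^sub>E i\<in>{1..d}. {1..k})"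
        using uv by (auto simp: grid_def)
      fix i assume i: "i \<in> {1..d}"
      then have "c i (u i) = c i (v i)" using merge_Int[OF _ i] uv by metis
      then show "u i = v i"
        using chain_le_iff[OF i, of "u i" "v i"] chain_le_iff[OF i, of "v i" "u i"] uv i
        by (auto simp: grid_def PiE_iff)
    qed
  qed
qed

text \<open>Membership in the sublattice becomes one condition per block, so that counts over
  independent choices of chains factorise.\<close>

lemma mem_merge_image_iff:
  assumes "Y \<subseteq> (\<Union>i\<in>{1..d}. P i)"
  shows "Y \<in> merge ` grid d (\<lambda>_. k) \<longleftrightarrow> (\<forall>i\<in>{1..d}. Y \<inter> P i \<in> c i ` {1..k})"
proof
  assume "Y \<in> merge ` grid d (\<lambda>_. k)"
  then obtain x where x: "x \<in> grid d (\<lambda>_. k)" "Y = merge x" by blast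
  then have "x i \<in> {1..k}" if "i \<in> {1..d}" for i
    using that by (auto simp: grid_def)
  then show "\<forall>i\<in>{1..d}. Y \<inter> P i \<in> c i ` {1..k}"
    using merge_Int[OF x(1)] x(2) by simp
next
  assume "\<forall>i\<in>{1..d}. Y \<inter> P i \<in> c i ` {1..k}"
  then have "\<forall>i\<in>{1..d}. \<exists>j. j \<in> {1..k} \<and> Y \<inter> P i = c i j" by blast
  from bchoice[OF this] obtain x
    where x: "\<And>i. i \<in> {1..d} \<Longrightarrow> x i \<in> {1..k} \<and> Y \<inter> P i = c i (x i)"
    by blast
  \<comment> \<open>The chosen \<open>x\<close> is arbitrary outside \<open>{1..d}\<close>;
    restricting it gives the default value that the grid requires.\<close>
  then have grid: "restrict x {1..d} \<in> grid d (\<lambda>_. k)" by (auto simp: grid_def)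
  moreover have "Y = merge (restrict x {1..d})"
    using merge_Int[OF grid] x by (intro set_eqI_blocks[OF assms merge_subset[OF grid]]) auto
  ultimately show "Y \<in> merge ` grid d (\<lambda>_. k)" by blast
qed

end

section \<open>Double counting over products of chains\<close>

lemma finite_grid: "finite (grid d k)"
  by (auto simp: grid_def intro: finite_PiE)

text \<open>Count pairs of a choice \<open>w\<close> of one chain per block and a member
  \<open>Y\<close> of \<open>H\<close> in the resulting sublattice. Each \<open>w\<close> occurs in
  at most \<open>ex_grid k d m C\<close> pairs, each \<open>Y\<close> in the same number of pairs;
  the factorials cancel.\<close>

lemma avoiding_family_bound:
  fixes P :: "nat \<Rightarrow> 'a set"
  assumes C: "affine_configuration m C" and disj: "disjoint_family_on P {1..d}"
    and fin: "\<And>i. i \<in> {1..d} \<Longrightarrow> finite (P i)"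
    and k: "\<And>i j. i \<in> {1..d} \<Longrightarrow> k * (card (P i) choose j) \<le> 2 ^ card (P i)"
    and H: "H \<subseteq> Pow (\<Union>i\<in>{1..d}. P i)" "avoids_config m C H"
  shows "card H * k ^ d \<le> 2 ^ card (\<Union>i\<in>{1..d}. P i) * ex_grid k d m C"
proof -
  let ?X = "\<Union>i\<in>{1..d}. P i" and ?G = "grid d (\<lambda>_. k)"
  have "\<exists>(\<Omega> :: ('a list \<times> nat) set) g. finite \<Omega> \<and> card \<Omega> = fact (card (P i)) * 2 ^ card (P i) \<and>
    (\<forall>\<omega>\<in>\<Omega>. strict_mono_on {1..k} (g \<omega>) \<and> (\<forall>j\<in>{1..k}. g \<omega> j \<subseteq> P i)) \<and>
    (\<forall>A. A \<subseteq> P i \<longrightarrow> card {\<omega>\<in>\<Omega>. A \<in> g \<omega> ` {1..k}} = k * fact (card (P i)))"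
    (is "\<exists>\<Omega> g. ?Q i \<Omega> g") if "i \<in> {1..d}" for i
  proof (rule uniform_chains[OF fin[OF that] k[OF that]])
    fix \<Omega> :: "('a list \<times> nat) set" and g :: "'a list \<times> nat \<Rightarrow> nat \<Rightarrow> 'a set"
    assume "finite \<Omega>" "card \<Omega> = fact (card (P i)) * 2 ^ card (P i)"
      "\<And>\<omega>. \<omega> \<in> \<Omega> \<Longrightarrow> strict_mono_on {1..k} (g \<omega>)"
      "\<And>\<omega> j. \<omega> \<in> \<Omega> \<Longrightarrow> j \<in> {1..k} \<Longrightarrow> g \<omega> j \<subseteq> P i"
      "\<And>A. A \<subseteq> P i \<Longrightarrow> card {\<omega> \<in> \<Omega>. A \<in> g \<omega> ` {1..k}} = k * fact (card (P i))"
    then have "?Q i \<Omega> g" by simp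
    then show "\<exists>\<Omega> g. ?Q i \<Omega> g" by blast
  qed
  then have "\<forall>i\<in>{1..d}. \<exists>\<Omega> g. ?Q i \<Omega> g" by (rule ballI)
  from bchoice[OF this] obtain \<Omega> where "\<forall>i\<in>{1..d}. \<exists>g. ?Q i (\<Omega> i) g" ..
  from bchoice[OF this] obtain g where "\<forall>i\<in>{1..d}. ?Q i (\<Omega> i) (g i)" ..
  then have \<Omega>: "?Q i (\<Omega> i) (g i)" if "i \<in> {1..d}" for i
    using that by (rule bspec)
  define W where "W = (\<Pi>\<^sub>E i\<in>{1..d}. \<Omega> i)"
  define \<Phi> where "\<Phi> w = chain_product.merge d (\<lambda>i. g i (w i))" for w
  have cp: "chain_product d k P (\<lambda>i. g i (w i))" if "w \<in> W" for w
    using \<Omega> that disj by unfold_locales (auto simp: W_def PiE_iff)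
  have finH: "finite H"
    using H(1) fin by (auto intro: finite_subset)
  have finW: "finite W"
    unfolding W_def using \<Omega> by (intro finite_PiE) auto
  \<comment> \<open>The trace of \<open>H\<close> on the sublattice is pulled back to the grid,
    where it still avoids \<open>C\<close>.\<close>
  have "card {Y \<in> H. Y \<in> \<Phi> w ` ?G} \<le> ex_grid k d m C" if w: "w \<in> W" for w
  proof -
    interpret chain_product d k P "\<lambda>i. g i (w i)" by (rule cp[OF w])
    interpret lattice_embedding_on ?G merge by (rule lattice_embedding_on_merge)
    have "{Y \<in> H. Y \<in> \<Phi> w ` ?G} = merge ` {x \<in> ?G. merge x \<in> H}"
      by (auto simp: \<Phi>_def)
    then have "card {Y \<in> H. Y \<in> \<Phi> w ` ?G} = card {x \<in> ?G. merge x \<in> H}"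
      using inj by (simp add: card_image inj_on_subset)
    also have "\<dots> \<le> ex_grid k d m C"
      unfolding ex_grid_def
      by (rule card_le_ex_in) (use finite_grid avoids_config_vimage[OF C H(2)] in auto)
    finally show ?thesis .
  qed
  then have "(\<Sum>w\<in>W. card {Y \<in> H. Y \<in> \<Phi> w ` ?G}) \<le> card W * ex_grid k d m C"
    using sum_bounded_above by (metis (no_types, lifting) of_nat_id)
  also have "card W = (\<Prod>i\<in>{1..d}. fact (card (P i)) * 2 ^ card (P i))"
    unfolding W_def using \<Omega> by (subst card_PiE) (auto intro!: prod.cong)
  also have "\<dots> = (\<Prod>i\<in>{1..d}. fact (card (P i))) * 2 ^ (\<Sum>i\<in>{1..d}. card (P i))"
    by (simp add: prod.distrib power_sum)
  also have "(\<Sum>i\<in>{1..d}. card (P i)) = card ?X"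
    using fin disj by (subst card_UN_disjoint) (auto simp: disjoint_family_on_def)
  finally have upper: "(\<Sum>w\<in>W. card {Y \<in> H. Y \<in> \<Phi> w ` ?G})
    \<le> (\<Prod>i\<in>{1..d}. fact (card (P i))) * 2 ^ card ?X * ex_grid k d m C" .
  have "card {w \<in> W. Y \<in> \<Phi> w ` ?G} = (\<Prod>i\<in>{1..d}. k * fact (card (P i)))" if "Y \<in> H" for Y
  proof -
    have "{w \<in> W. Y \<in> \<Phi> w ` ?G} = (\<Pi>\<^sub>E i\<in>{1..d}. {\<omega> \<in> \<Omega> i. Y \<inter> P i \<in> g i \<omega> ` {1..k}})"
    proof (intro set_eqI)
      fix w
      have "Y \<subseteq> ?X" using that H(1) by blast
      then have "w \<in> W \<Longrightarrow> Y \<in> \<Phi> w ` ?G \<longleftrightarrow> (\<forall>i\<in>{1..d}. Y \<inter> P i \<in> g i (w i) ` {1..k})"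
        unfolding \<Phi>_def using chain_product.mem_merge_image_iff[OF cp] by blast
      then show "w \<in> {w \<in> W. Y \<in> \<Phi> w ` ?G} \<longleftrightarrow>
        w \<in> (\<Pi>\<^sub>E i\<in>{1..d}. {\<omega> \<in> \<Omega> i. Y \<inter> P i \<in> g i \<omega> ` {1..k}})"
        by (auto simp: W_def PiE_iff)
    qed
    then show ?thesis
      using \<Omega> by (simp only: card_PiE[OF finite_atLeastAtMost]) (intro prod.cong; simp)
  qed
  then have "(\<Sum>w\<in>W. card {Y \<in> H. Y \<in> \<Phi> w ` ?G}) = (\<Sum>Y\<in>H. \<Prod>i\<in>{1..d}. k * fact (card (P i)))"
    by (intro sum_multicount_gen[OF finW finH]) blast
  also have "\<dots> = (\<Prod>i\<in>{1..d}. fact (card (P i))) * (card H * k ^ d)"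
    by (simp add: prod.distrib)
  finally show ?thesis
    using upper by (simp add: mult.assoc)
qed

text \<open>By Pascal's rule an entry of the next row is at most twice the maximum of the current
  one, while the power of 2 doubles. Blocks of different sizes can therefore share one
  \<open>k\<close>.\<close>

lemma binomial_density_mono:
  assumes "N \<le> N'" "\<And>j. k * (N choose j) \<le> 2 ^ N"
  shows "k * (N' choose j) \<le> 2 ^ N'"
  using assms(1)
proof (induction N' arbitrary: j rule: dec_induct)
  case (step n)
  show ?case
  proof (cases j)
    case 0
    then show ?thesis using step.IH[of 0] by simp
  next
    case (Suc i)
    then show ?thesis using step.IH[of i] step.IH[of j] by (simp add: distrib_left)
  qed
qed (rule assms(2))

lemma ex_cube_le_ex_grid:
  assumes "affine_configuration m C" "d > 0" "d * N \<le> n"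
    and k: "\<And>j. k * (N choose j) \<le> 2 ^ N"
  shows "ex_cube n m C * k ^ d \<le> 2 ^ n * ex_grid k d m C"
proof -
  \<comment> \<open>The blocks are residue classes; \<open>x - 1\<close> and \<open>Suc\<close> turn
    the residues \<open>0, ..., d - 1\<close> into the indices \<open>1, ..., d\<close>.\<close>
  define P where "P i = {x \<in> {1..n}. Suc ((x - 1) mod d) = i}" for i
  have X: "(\<Union>i\<in>{1..d}. P i) = {1..n}"
    using \<open>d > 0\<close> by (auto simp: P_def Suc_le_eq)
  have large: "N \<le> card (P i)" if i: "i \<in> {1..d}" for i
  proof -
    \<comment> \<open>These are \<open>N\<close> distinct members of the block, none above
      \<open>N * d\<close>.\<close>
    have "(\<lambda>q. q * d + i) ` {..<N} \<subseteq> P i"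
    proof (rule image_subsetI)
      fix q assume "q \<in> {..<N}"
      then have "q * d + d \<le> N * d" using mult_le_mono1[of "Suc q" N d] by simp
      then have "q * d + i \<le> n" using i assms(3) by (simp add: mult.commute)
      moreover have "q * d + i - 1 = i - 1 + q * d" using i by simp
      moreover have "(i - 1) mod d = i - 1" using i by (intro mod_less) auto
      ultimately have "(q * d + i - 1) mod d = i - 1" "q * d + i \<le> n"
        by (simp_all only: mod_mult_self1)
      then show "q * d + i \<in> P i" using i by (auto simp: P_def)
    qed
    then have "card ((\<lambda>q. q * d + i) ` {..<N}) \<le> card (P i)"
      by (rule card_mono[rotated]) (simp add: P_def)
    then show ?thesis
      using \<open>d > 0\<close> by (simp add: card_image inj_on_def)
  qed
  obtain H where H: "H \<subseteq> Pow {1..n}" "avoids_config m C H" "card H = ex_cube n m C"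
    using ex_in_attained[of "Pow {1..n}" m C] affine_configuration_pos[OF assms(1)]
    unfolding ex_cube_def by auto
  have "card H * k ^ d \<le> 2 ^ card (\<Union>i\<in>{1..d}. P i) * ex_grid k d m C"
  proof (rule avoiding_family_bound[OF assms(1) _ _ _ _ H(2)])
    show "disjoint_family_on P {1..d}" by (auto simp: disjoint_family_on_def P_def)
    show "finite (P i)" for i by (simp add: P_def)
    show "k * (card (P i) choose j) \<le> 2 ^ card (P i)" if "i \<in> {1..d}" for i j
      using binomial_density_mono[OF large[OF that] k] .
    show "H \<subseteq> Pow (\<Union>i\<in>{1..d}. P i)" unfolding X by (rule H(1))
  qed
  then show ?thesis unfolding X H(3) by simp
qed

section \<open>Asymptotics of the chain length\<close>

text \<open>Passing from \<open>p\<close> to \<open>p + 1\<close> multiplies the central coefficient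
  by \<open>2 * (2 * p + 1) / (p + 1)\<close>, and \<open>4 * (p + 1) ^ 2 - 1\<close> is
  \<open>(2 * p + 1) * (2 * p + 3)\<close>, so both sides grow by the factor 16.\<close>

lemma wallis_central_binomial:
  "(4 ^ p) ^ 2 = (\<Prod>k=1..p. (4 * real k ^ 2) / (4 * real k ^ 2 - 1))
     * (2 * real p + 1) * real ((2 * p) choose p) ^ 2"
proof (induction p)
  case (Suc p)
  let ?W = "\<Prod>k=1..p. (4 * real k ^ 2) / (4 * real k ^ 2 - 1)"
  let ?c = "real ((2 * p) choose p)" and ?c' = "real ((2 * Suc p) choose Suc p)"
  \<comment> \<open>The absorption identity is applied twice, with the symmetry of the odd row in
    between.\<close>
  have "Suc p * ((2 * Suc p) choose Suc p) = Suc (Suc (2 * p)) * (Suc (2 * p) choose p)"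
    using Suc_times_binomial[of p "Suc (2 * p)"] by simp
  also have "(Suc (2 * p) choose p) = (Suc (2 * p) choose Suc p)"
    by (subst binomial_symmetric) auto
  also have "Suc (Suc (2 * p)) * (Suc (2 * p) choose Suc p) = 2 * (Suc p * (Suc (2 * p) choose Suc p))"
    by (simp del: binomial_Suc_Suc)
  also have "\<dots> = 2 * (Suc (2 * p) * ((2 * p) choose p))"
    by (simp only: Suc_times_binomial)
  finally have "Suc p * ((2 * Suc p) choose Suc p) = 2 * (Suc (2 * p) * ((2 * p) choose p))" .
  from arg_cong[OF this, of real]
  have c': "?c' = 2 * (2 * real p + 1) / (real p + 1) * ?c"
    by (simp add: field_simps del: binomial_Suc_Suc)
  have "4 * (real p + 1) ^ 2 - 1 = (2 * real p + 1) * (2 * real p + 3)"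
    by (simp add: power2_eq_square algebra_simps)
  then have "(4 * (real p + 1) ^ 2) / (4 * (real p + 1) ^ 2 - 1) * (2 * real p + 3) * ?c' ^ 2
      = 16 * (2 * real p + 1) * ?c ^ 2"
    unfolding c' by (simp add: divide_simps power2_eq_square) (simp add: algebra_simps)
  then have "?W * ((4 * (real p + 1) ^ 2) / (4 * (real p + 1) ^ 2 - 1) * (2 * real p + 3) * ?c' ^ 2)
      = 16 * (?W * (2 * real p + 1) * ?c ^ 2)"
    by simp
  also have "\<dots> = 16 * (4 ^ p) ^ 2"
    by (simp only: Suc.IH)
  finally show ?case
    by (simp add: algebra_simps power2_eq_square del: binomial_Suc_Suc)
qed simp

text \<open>The square of the ratio is Wallis' partial product times \<open>2 + 1 / p\<close>, and
  that product tends to \<open>pi / 2\<close>.\<close>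

lemma central_binomial_ratio_asymp:
  "(\<lambda>p. 4 ^ p / real ((2 * p) choose p) / sqrt (real p)) \<longlonglongrightarrow> sqrt pi"
proof -
  let ?W = "\<lambda>p. \<Prod>k=1..p. (4 * real k ^ 2) / (4 * real k ^ 2 - 1)"
  have "(\<lambda>p. ?W p * (2 + 1 / real p)) \<longlonglongrightarrow> pi / 2 * (2 + 0)"
    by (intro tendsto_intros wallis lim_1_over_n)
  then have "(\<lambda>p. sqrt (?W p * (2 + 1 / real p))) \<longlonglongrightarrow> sqrt pi"
    by (auto dest: tendsto_real_sqrt)
  moreover have "\<forall>\<^sub>F p in sequentially. sqrt (?W p * (2 + 1 / real p))
      = 4 ^ p / real ((2 * p) choose p) / sqrt (real p)"
  proof (rule eventually_mono[OF eventually_gt_at_top[of 0]])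
    fix p :: nat assume p: "p > 0"
    have c: "real ((2 * p) choose p) > 0" by simp
    have "?W p * (2 + 1 / real p) = ?W p * (2 * real p + 1) / real p"
      using p by (simp add: field_simps)
    also have "?W p * (2 * real p + 1) = (4 ^ p) ^ 2 / real ((2 * p) choose p) ^ 2"
      using wallis_central_binomial[of p] c by (simp add: field_simps)
    finally have "?W p * (2 + 1 / real p) = (4 ^ p / real ((2 * p) choose p)) ^ 2 / real p"
      by (simp only: power_divide)
    then show "sqrt (?W p * (2 + 1 / real p)) = 4 ^ p / real ((2 * p) choose p) / sqrt (real p)"
      by (simp add: real_sqrt_divide)
  qed
  ultimately show ?thesis by (rule Lim_transform_eventually)
qed

section \<open>Integer chain lengths\<close>

lemma real_div_nat_bounds:
  "real m / real n - 1 \<le> real (m div n)" "real (m div n) \<le> real m / real n"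
proof -
  have "real (m div n) = of_int \<lfloor>real m / real n\<rfloor>"
    by (simp add: floor_divide_of_nat_eq)
  then show "real m / real n - 1 \<le> real (m div n)" "real (m div n) \<le> real m / real n"
    by linarith+
qed

text \<open>Rounding down costs at most 1, which vanishes after division by
  \<open>sqrt p\<close>.\<close>

lemma chain_length_asymp:
  "(\<lambda>p. real (4 ^ p div ((2 * p) choose p)) / sqrt (real p)) \<longlonglongrightarrow> sqrt pi"
proof (rule tendsto_sandwich)
  let ?q = "\<lambda>p. 4 ^ p / real ((2 * p) choose p)"
  have "(\<lambda>p. ?q p / sqrt (real p) - 1 / sqrt (real p)) \<longlonglongrightarrow> sqrt pi - 0"
    by (intro tendsto_diff central_binomial_ratio_asymp tendsto_divide_0[OF tendsto_const]
        filterlim_at_top_imp_at_infinity filterlim_compose[OF sqrt_at_top filterlim_real_sequentially])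
  then show "(\<lambda>p. ?q p / sqrt (real p) - 1 / sqrt (real p)) \<longlonglongrightarrow> sqrt pi" by simp
  have "?q p - 1 \<le> real (4 ^ p div ((2 * p) choose p))" for p
    using real_div_nat_bounds(1)[of "4 ^ p" "(2 * p) choose p"] by simp
  from divide_right_mono[OF this]
  show "\<forall>\<^sub>F p in sequentially. ?q p / sqrt (real p) - 1 / sqrt (real p)
      \<le> real (4 ^ p div ((2 * p) choose p)) / sqrt (real p)"
    by (simp add: diff_divide_distrib)
  have "real (4 ^ p div ((2 * p) choose p)) \<le> ?q p" for p
    using real_div_nat_bounds(2)[of "4 ^ p" "(2 * p) choose p"] by simp
  from divide_right_mono[OF this]
  show "\<forall>\<^sub>F p in sequentially. real (4 ^ p div ((2 * p) choose p)) / sqrt (real p)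
      \<le> ?q p / sqrt (real p)"
    by simp
qed (rule central_binomial_ratio_asymp)

lemma tendsto_div_const_nat_over:
  assumes "D > 0"
  shows "(\<lambda>n. real (n div D) / real n) \<longlonglongrightarrow> 1 / real D"
proof (rule tendsto_sandwich)
  have "(\<lambda>n. 1 / real D - 1 / real n) \<longlonglongrightarrow> 1 / real D - 0"
    by (intro tendsto_intros lim_1_over_n)
  then show "(\<lambda>n. 1 / real D - 1 / real n) \<longlonglongrightarrow> 1 / real D" by simp
  show "\<forall>\<^sub>F n in sequentially. 1 / real D - 1 / real n \<le> real (n div D) / real n"
  proof (rule eventually_mono[OF eventually_gt_at_top[of 0]])
    fix n :: nat assume "n > 0"
    moreover have "real n / real D - 1 \<le> real (n div D)"
      using real_div_nat_bounds(1)[of n D] by simp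
    ultimately show "1 / real D - 1 / real n \<le> real (n div D) / real n"
      using divide_right_mono[of "real n / real D - 1" "real (n div D)" "real n"]
      by (simp add: diff_divide_distrib)
  qed
  show "\<forall>\<^sub>F n in sequentially. real (n div D) / real n \<le> 1 / real D"
  proof (rule eventually_mono[OF eventually_gt_at_top[of 0]])
    fix n :: nat assume "n > 0"
    then show "real (n div D) / real n \<le> 1 / real D"
      using divide_right_mono[OF real_div_nat_bounds(2)[of n D], of "real n"] by simp
  qed
qed simp

text \<open>\<open>K n\<close> is the largest \<open>k\<close> admissible for a block of size
  \<open>2 * (n div D)\<close>, even so that the largest coefficient is the one Wallis' product
  controls. It is compared with \<open>sqrt (n div D)\<close>, and this with
  \<open>sqrt n\<close>.\<close>

lemma chain_length_asymp_div:
  assumes "D > 0"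
  defines "K \<equiv> \<lambda>n. 4 ^ (n div D) div ((2 * (n div D)) choose (n div D))"
  shows "(\<lambda>n. real (K n) * sqrt (real D / (pi * real n))) \<longlonglongrightarrow> 1"
proof -
  have p: "filterlim (\<lambda>n. n div D) at_top at_top"
    using assms(1) by (rule filterlim_at_top_div_const_nat)
  have "(\<lambda>n. real (K n) / sqrt (real (n div D)) * sqrt (real (n div D) / real n) * sqrt (real D / pi))
      \<longlonglongrightarrow> sqrt pi * sqrt (1 / real D) * sqrt (real D / pi)"
    unfolding K_def
    by (intro tendsto_mult tendsto_const tendsto_real_sqrt tendsto_div_const_nat_over assms(1)
        filterlim_compose[OF chain_length_asymp p])
  also have "sqrt pi * sqrt (1 / real D) * sqrt (real D / pi) = 1"
    using assms(1) by (simp add: real_sqrt_divide)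
  finally have lim: "(\<lambda>n. real (K n) / sqrt (real (n div D)) * sqrt (real (n div D) / real n)
      * sqrt (real D / pi)) \<longlonglongrightarrow> 1" .
  have "\<forall>\<^sub>F n in sequentially. n div D > 0"
    using p eventually_gt_at_top[of 0] by (auto simp: filterlim_iff)
  then have "\<forall>\<^sub>F n in sequentially. real (K n) / sqrt (real (n div D)) * sqrt (real (n div D) / real n)
      * sqrt (real D / pi) = real (K n) * sqrt (real D / (pi * real n))"
    by (rule eventually_mono) (simp add: real_sqrt_divide real_sqrt_mult)
  with lim show ?thesis by (rule Lim_transform_eventually)
qed

text \<open>The length is a factor tending to 1 times \<open>sqrt (pi * n / D)\<close>. This allows
  a bound known only for large \<open>k\<close> to be applied to it.\<close>

lemma filterlim_chain_length:
  assumes "D > 0"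
  shows "filterlim (\<lambda>n. 4 ^ (n div D) div ((2 * (n div D)) choose (n div D))) at_top sequentially"
    (is "filterlim ?K _ _")
proof -
  have s: "filterlim (\<lambda>n. sqrt (pi * real n / real D)) at_top sequentially"
  proof (rule filterlim_compose[OF sqrt_at_top])
    have "filterlim (\<lambda>n. pi / real D * real n) at_top sequentially"
      using assms by (intro filterlim_tendsto_pos_mult_at_top[OF tendsto_const _ filterlim_real_sequentially]) simp
    then show "filterlim (\<lambda>n. pi * real n / real D) at_top sequentially" by simp
  qed
  have "filterlim (\<lambda>n. real (?K n) * sqrt (real D / (pi * real n)) * sqrt (pi * real n / real D))
      at_top sequentially"
    by (rule filterlim_tendsto_pos_mult_at_top[OF chain_length_asymp_div[OF assms] _ s]) simp
  moreover have "\<forall>\<^sub>F n in sequentially. real (?K n) * sqrt (real D / (pi * real n)) * sqrt (pi * real n / real D)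
      = real (?K n)"
    using assms by (intro eventually_mono[OF eventually_gt_at_top[of 0]])
      (simp add: mult.assoc real_sqrt_mult[symmetric])
  ultimately have "filterlim (\<lambda>n. real (?K n)) at_top sequentially"
    by (simp cong: filterlim_cong)
  then show ?thesis
    by (simp add: filterlim_sequentially_iff_filterlim_real)
qed

section \<open>Choice of parameters and final estimate\<close>

theorem theorem3p1:
  fixes C :: affine_config and m d :: nat and c \<alpha> :: real
  assumes "affine_configuration m C"
    and "d > 0" and "c > 0" and "\<alpha> > 0"
    and "eventually (\<lambda>k. real (ex_grid k d m C) \<le> c * real k powr (real d - \<alpha>)) at_top"
  shows "\<exists>\<epsilon> :: nat \<Rightarrow> real. \<epsilon> \<in> o(\<lambda>_. 1) \<and>
           eventually (\<lambda>n. real (ex_cube n m C)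
             \<le> (1 + \<epsilon> n) * c * (2 * real d / (pi * real n)) powr (\<alpha> / 2) * 2 ^ n) at_top"
proof -
  \<comment> \<open>Every one of the \<open>d\<close> blocks has at least \<open>2 * p n\<close>
    elements, and \<open>K n\<close> is the longest chain that this size allows.\<close>
  define p where "p n = n div (2 * d)" for n
  define K where "K n = 4 ^ p n div ((2 * p n) choose p n)" for n
  define x where "x n = sqrt (2 * real d / (pi * real n))" for n
  \<comment> \<open>\<open>x n\<close> is the reciprocal of the asymptotic size of
    \<open>K n\<close>, and \<open>\<epsilon> n\<close> is the exact error that gives \<open>(1 +
    \<epsilon> n) * x n powr \<alpha> = K n powr (- \<alpha>)\<close>.\<close>
  define \<epsilon> where "\<epsilon> n = (real (K n) * x n) powr (- \<alpha>) - 1" for n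
  have D: "2 * d > 0" using \<open>d > 0\<close> by simp
  have "(\<lambda>n. real (K n) * x n) \<longlonglongrightarrow> 1"
    using chain_length_asymp_div[OF D] by (simp add: K_def p_def x_def)
  then have "\<epsilon> \<longlonglongrightarrow> 1 powr (- \<alpha>) - 1"
    unfolding \<epsilon>_def by (intro tendsto_intros) auto
  then have "\<epsilon> \<in> o(\<lambda>_. 1)"
    by (intro smalloI_tendsto) auto
  moreover have "\<forall>\<^sub>F n in at_top. real (ex_cube n m C)
      \<le> (1 + \<epsilon> n) * c * (2 * real d / (pi * real n)) powr (\<alpha> / 2) * 2 ^ n"
  proof -
    have K: "filterlim K at_top at_top"
      using filterlim_chain_length[OF D] by (simp add: K_def[abs_def] p_def)
    have "\<forall>\<^sub>F n in at_top. real (ex_grid (K n) d m C) \<le> c * real (K n) powr (real d - \<alpha>)"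
      using assms(5) K by (rule eventually_compose_filterlim)
    moreover have "\<forall>\<^sub>F n in at_top. K n > 0"
      using K eventually_gt_at_top[of 0] by (auto simp: filterlim_iff)
    ultimately show ?thesis
      using eventually_gt_at_top[of "0::nat"]
    proof eventually_elim
      case (elim n)
      have k: "K n * ((2 * p n) choose j) \<le> 2 ^ (2 * p n)" for j
      proof -
        have "K n * ((2 * p n) choose j) \<le> K n * ((2 * p n) choose p n)"
          by (intro mult_le_mono2 binomial_maximum')
        also have "\<dots> \<le> 2 ^ (2 * p n)"
          by (simp add: K_def power_mult)
        finally show ?thesis .
      qed
      have "d * (2 * p n) \<le> n"
        using times_div_less_eq_dividend[of "2 * d" n] by (simp add: p_def ac_simps)
      from ex_cube_le_ex_grid[OF assms(1,2) this k]
      have "real (ex_cube n m C * K n ^ d) \<le> real (2 ^ n * ex_grid (K n) d m C)"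
        by (simp only: of_nat_le_iff)
      then have "real (ex_cube n m C) * real (K n) ^ d \<le> 2 ^ n * real (ex_grid (K n) d m C)"
        by simp
      also have "\<dots> \<le> 2 ^ n * (c * real (K n) powr (real d - \<alpha>))"
        using elim(1) by simp
      \<comment> \<open>Splitting off \<open>K n ^ d\<close> prepares its cancellation against the
        left side, valid as \<open>K n > 0\<close>.\<close>
      also have "real (K n) powr (real d - \<alpha>) = real (K n) powr (- \<alpha>) * real (K n) ^ d"
        using elim(2) by (simp add: powr_diff powr_minus powr_realpow field_simps)
      finally have "real (ex_cube n m C) * real (K n) ^ d
          \<le> (2 ^ n * c * real (K n) powr (- \<alpha>)) * real (K n) ^ d"
        by (simp add: mult.assoc)
      then have "real (ex_cube n m C) \<le> 2 ^ n * c * real (K n) powr (- \<alpha>)"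
        using elim(2) by (simp only: mult_le_cancel_right_pos zero_less_power of_nat_0_less_iff)
      also have "real (K n) powr (- \<alpha>) = (1 + \<epsilon> n) * (2 * real d / (pi * real n)) powr (\<alpha> / 2)"
      proof -
        have x: "x n > 0" using elim(3) \<open>d > 0\<close> by (simp add: x_def)
        have "x n powr \<alpha> = (2 * real d / (pi * real n)) powr (\<alpha> / 2)"
          using elim(3) \<open>d > 0\<close> by (simp add: x_def powr_half_sqrt[symmetric] powr_powr)
        moreover have "(1 + \<epsilon> n) * x n powr \<alpha> = real (K n) powr (- \<alpha>)"
          using x by (simp add: \<epsilon>_def powr_mult powr_add[symmetric])
        ultimately show ?thesis by simp
      qed
      finally show ?case by (simp add: ac_simps)
    qed
  qed
  ultimately show ?thesis by blast
qed

end
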